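(* Let $\lambda$ be a nonzero real number, let $a<b$ be real numbers with $a+b\ne0$, and let $Y$ be the uniform random variable over $(a,b)$, i.e. with density $\frac{1}{b-a}$ on $(a,b)$ and $0$ otherwise. Then, for all integers $n\ge k\ge 0$, $$S_{2}^{Y}(n,k)=\frac{1}{k!}\sum_{j=0}^{k}\sum_{l=0}^{n}\binom{n}{l}\binom{k}{j}\binom{l+j}{j}^{-1}(-1)^{k-j}(aj)^{n-l}(b-a)^{l}S_{2}(l+j,j),$$ $$S_{2,\lambda}^{Y}(n,k)=\frac{1}{k!}\sum_{m=0}^{n}\sum_{j=0}^{k}\sum_{l=0}^{m}\binom{m}{l}\binom{k}{j}\binom{l+j}{j}^{-1}(-1)^{k-j}(aj)^{m-l}(b-a)^{l}\lambda^{n-m}S_{2}(l+j,j)S_{1}(n,m).$$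
   Context: Convention: $0^0=1$. $S_2(n,k)$ and $S_1(n,k)$ are the Stirling numbers of the second kind and the (signed) Stirling numbers of the first kind: $\frac{1}{k!}(e^t-1)^k=\sum_{n\ge k}S_2(n,k)\frac{t^n}{n!}$, $\frac{1}{k!}(\log(1+t))^k=\sum_{n\ge k}S_1(n,k)\frac{t^n}{n!}$. For nonzero real $\lambda$: $(x)_{0,\lambda}=1$, $(x)_{n,\lambda}=x(x-\lambda)\cdots(x-(n-1)\lambda)$; $e_\lambda^x(t)=(1+\lambda t)^{x/\lambda}=\sum_{n\ge0}(x)_{n,\lambda}\frac{t^n}{n!}$. For a random variable $Y$ whose moment generating function exists near $0$ and with $E[Y]\ne0$, put $e_Y(t)=E[e^{Yt}]-1=\sum_{n\ge1}E[Y^n]\frac{t^n}{n!}$ and $e_{Y,\lambda}(t)=E[e_\lambda^Y(t)]-1=\sum_{n\ge1}E[(Y)_{n,\lambda}]\frac{t^n}{n!}$ (power series in $t$). The probabilistic Stirling numbers of the second kind $S_2^Y(n,k)$ and the probabilistic degenerate Stirling numbers of the second kind $S_{2,\lambda}^Y(n,k)$ associated with $Y$ are defined, for $k\ge0$, by $\frac{1}{k!}(e_Y(t))^k=\sum_{n\ge k}S_2^Y(n,k)\frac{t^n}{n!}$ and $\frac{1}{k!}(e_{Y,\lambda}(t))^k=\sum_{n\ge k}S_{2,\lambda}^Y(n,k)\frac{t^n}{n!}$. *)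

theory Defs
  imports
    "HOL-Probability.Probability"
    "HOL-Computational_Algebra.Formal_Power_Series"
    "HOL-Combinatorics.Stirling"
begin

text \<open>
  A sequence with exponential generating function \<open>F\<close>, i.e.\ \<open>F = (\<Sum>n. c n * t ^ n / n!)\<close>, is
  read off as \<open>c n = n! * fps_nth F n\<close>. The series \<open>F\<close> used below are \<open>k\<close>-th powers of series without
  constant term, so \<open>c n = 0\<close> for \<open>n < k\<close>.

  For the Stirling numbers of the second kind we use the library function \<open>Stirling\<close>; the lemma
  \<open>Stirling_egf\<close> below shows that it has the generating function \<open>(exp t - 1) ^ k / k!\<close>.
  The library function \<open>stirling\<close> is unsigned, hence the following definition, in which
  \<open>fps_ln 1\<close> is the series of \<open>log (1 + t)\<close>.
\<close>

definition signed_stirling1 :: "nat \<Rightarrow> nat \<Rightarrow> real" where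
  "signed_stirling1 n k = fact n * fps_nth (fps_const (1 / fact k) * fps_ln 1 ^ k) n"

definition degenerate_falling :: "real \<Rightarrow> real \<Rightarrow> nat \<Rightarrow> real" where
  "degenerate_falling lam x n = (\<Prod>i<n. x - real i * lam)"

text \<open>
  The power series of \<open>E[exp (Y t)] - 1\<close> and of \<open>E[(1 + lam t) powr (Y / lam)] - 1\<close>; see
  \<open>exp_moment_has_fps_expansion\<close> and \<open>degenerate_exp_moment_has_fps_expansion\<close> below.
\<close>

definition exp_moment_fps :: "'a measure \<Rightarrow> ('a \<Rightarrow> real) \<Rightarrow> real fps" where
  "exp_moment_fps M Y =
     Abs_fps (\<lambda>n. if n = 0 then 0 else (\<integral>\<omega>. Y \<omega> ^ n \<partial>M) / fact n)"

definition degenerate_exp_moment_fps :: "real \<Rightarrow> 'a measure \<Rightarrow> ('a \<Rightarrow> real) \<Rightarrow> real fps" where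
  "degenerate_exp_moment_fps lam M Y =
     Abs_fps (\<lambda>n. if n = 0 then 0 else (\<integral>\<omega>. degenerate_falling lam (Y \<omega>) n \<partial>M) / fact n)"

definition prob_Stirling :: "'a measure \<Rightarrow> ('a \<Rightarrow> real) \<Rightarrow> nat \<Rightarrow> nat \<Rightarrow> real" where
  "prob_Stirling M Y n k =
     fact n * fps_nth (fps_const (1 / fact k) * exp_moment_fps M Y ^ k) n"

definition prob_degenerate_Stirling ::
    "real \<Rightarrow> 'a measure \<Rightarrow> ('a \<Rightarrow> real) \<Rightarrow> nat \<Rightarrow> nat \<Rightarrow> real" where
  "prob_degenerate_Stirling lam M Y n k =
     fact n * fps_nth (fps_const (1 / fact k) * degenerate_exp_moment_fps lam M Y ^ k) n"


lemma Stirling_egf: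
  "real (Stirling n k) = fact n * fps_nth (fps_const (1 / fact k) * (fps_exp 1 - 1) ^ k) n"
proof (induction n k rule: Stirling.induct)
  case (4 n k)
  let ?E = "\<lambda>k. fps_const (1 / fact k :: real) * (fps_exp 1 - 1) ^ k"
  have "fps_deriv (?E (Suc k)) =
      fps_const (of_nat (Suc k) / fact (Suc k)) * (fps_exp 1 * (fps_exp 1 - 1) ^ k)"
    by (simp add: fps_deriv_power mult_ac fps_const_mult[symmetric] del: fps_const_mult power_Suc fact_Suc
          of_nat_Suc)
  also have "of_nat (Suc k) / fact (Suc k) = (1 / fact k :: real)"
    by (simp add: divide_simps del: of_nat_Suc)
  also have "fps_const (1 / fact k :: real) * (fps_exp 1 * (fps_exp 1 - 1) ^ k) =
      fps_const (1 / fact k) * (fps_exp 1 - 1) ^ Suc k + ?E k"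
    by (simp add: algebra_simps)
  also have "(1 / fact k :: real) = of_nat (Suc k) * (1 / fact (Suc k))"
    by (simp add: divide_simps del: of_nat_Suc)
  also have "fps_const (of_nat (Suc k) * (1 / fact (Suc k)) :: real) * (fps_exp 1 - 1) ^ Suc k
      = fps_const (of_nat (Suc k)) * ?E (Suc k)"
    by (simp only: fps_const_mult[symmetric] mult.assoc)
  finally have "fps_nth (fps_deriv (?E (Suc k))) n =
      of_nat (Suc k) * fps_nth (?E (Suc k)) n + fps_nth (?E k) n"
    by (simp only: fps_add_nth fps_mult_left_const_nth) (simp add: divide_simps)
  then have "fact n * (of_nat (Suc n) * fps_nth (?E (Suc k)) (Suc n)) =
      fact n * (of_nat (Suc k) * fps_nth (?E (Suc k)) n + fps_nth (?E k) n)"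
    by (simp only: fps_deriv_nth Suc_eq_plus1)
  then have "fact (Suc n) * fps_nth (?E (Suc k)) (Suc n) =
      fact n * (of_nat (Suc k) * fps_nth (?E (Suc k)) n + fps_nth (?E k) n)"
    unfolding fact_Suc by (simp only: algebra_simps of_nat_mult)
  then show ?case
    using 4 by (simp only: Stirling.simps of_nat_add of_nat_mult) (simp only: algebra_simps)
qed (simp_all)

lemma signed_stirling1_eq: "signed_stirling1 n k = (-1) ^ (n + k) * real (stirling n k)"
proof (induction n k rule: stirling.induct)
  case (4 n k)
  let ?E = "\<lambda>k. fps_const (1 / fact k :: real) * fps_ln 1 ^ k"
  have inv: "(1 + fps_X) * inverse (1 + fps_X) = (1 :: real fps)"
    by (subst mult.commute, rule inverse_mult_eq_1) simp
  have "(1 + fps_X) * fps_deriv (?E (Suc k)) =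
      ((1 + fps_X) * inverse (1 + fps_X)) *
        (fps_const (of_nat (Suc k) / fact (Suc k)) * fps_ln 1 ^ k)"
    by (simp add: fps_deriv_power fps_ln_deriv mult_ac fps_const_mult[symmetric] del: fps_const_mult power_Suc
          fact_Suc of_nat_Suc)
  also have "of_nat (Suc k) / fact (Suc k) = (1 / fact k :: real)"
    by (simp add: divide_simps del: of_nat_Suc)
  finally have "fps_nth ((1 + fps_X) * fps_deriv (?E (Suc k))) n = fps_nth (?E k) n"
    by (simp add: inv)
  moreover have "fps_nth ((1 + fps_X) * fps_deriv F) n =
      of_nat (Suc n) * fps_nth F (Suc n) + of_nat n * fps_nth F n" for F :: "real fps"
    by (cases n) (simp_all add: distrib_right)
  ultimately have "of_nat (Suc n) * fps_nth (?E (Suc k)) (Suc n) =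
      fps_nth (?E k) n - of_nat n * fps_nth (?E (Suc k)) n"
    by (metis add_diff_cancel_right')
  then have "fact n * (of_nat (Suc n) * fps_nth (?E (Suc k)) (Suc n)) =
      fact n * (fps_nth (?E k) n - of_nat n * fps_nth (?E (Suc k)) n)"
    by (simp only:)
  then have "signed_stirling1 (Suc n) (Suc k) =
      signed_stirling1 n k - of_nat n * signed_stirling1 n (Suc k)"
    unfolding signed_stirling1_def fact_Suc by (simp only: algebra_simps of_nat_mult)
  then show ?case
    using 4 by (simp add: algebra_simps)
qed (simp_all add: signed_stirling1_def)

lemma integral_has_fps_expansion:
  fixes c :: "nat \<Rightarrow> 'a \<Rightarrow> real"
  assumes s: "s > 0"
    and meas: "\<And>n. c n \<in> borel_measurable M" "\<And>t. f t \<in> borel_measurable M"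
    and g: "integrable M g"
    and bound: "\<And>\<omega>. (\<lambda>n. b n \<omega>) sums g \<omega>" "\<And>n \<omega>. \<bar>c n \<omega>\<bar> * s ^ n \<le> b n \<omega>"
    and sums: "\<And>t \<omega>. \<bar>t\<bar> < s \<Longrightarrow> (\<lambda>n. c n \<omega> * t ^ n) sums f t \<omega>"
  shows "(\<lambda>t. \<integral>\<omega>. f t \<omega> \<partial>M) has_fps_expansion Abs_fps (\<lambda>n. \<integral>\<omega>. c n \<omega> \<partial>M)"
proof (rule has_fps_expansionI)
  have b0: "b n \<omega> \<ge> 0" for n \<omega>
    using bound(2)[of n \<omega>] s by (smt (verit) mult_nonneg_nonneg zero_le_power abs_ge_zero)
  have "(\<lambda>n. (\<integral>\<omega>. c n \<omega> \<partial>M) * t ^ n) sums (\<integral>\<omega>. f t \<omega> \<partial>M)" if t: "\<bar>t\<bar> < s" for t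
  proof -
    have term_le: "\<bar>c n \<omega> * t ^ n\<bar> \<le> b n \<omega>" for n \<omega>
    proof -
      have "\<bar>c n \<omega> * t ^ n\<bar> \<le> \<bar>c n \<omega>\<bar> * s ^ n"
        using t by (auto simp: abs_mult power_abs intro!: mult_left_mono power_mono)
      then show ?thesis using bound(2)[of n \<omega>] by linarith
    qed
    have partial_le: "(\<Sum>n<N. \<bar>c n \<omega> * t ^ n\<bar>) \<le> g \<omega>" for N \<omega>
    proof -
      have "(\<Sum>n<N. \<bar>c n \<omega> * t ^ n\<bar>) \<le> (\<Sum>n<N. b n \<omega>)"
        by (intro sum_mono term_le)
      also have "\<dots> \<le> (\<Sum>n. b n \<omega>)"
        using bound(1)[of \<omega>] b0 by (intro sum_le_suminf) (auto simp: sums_iff)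
      also have "\<dots> = g \<omega>" using bound(1)[of \<omega>] by (simp add: sums_iff)
      finally show ?thesis .
    qed
    have int: "integrable M (\<lambda>\<omega>. c n \<omega> * t ^ n)" for n
    proof (rule Bochner_Integration.integrable_bound[OF g])
      have "\<bar>c n \<omega> * t ^ n\<bar> \<le> \<bar>g \<omega>\<bar>" for \<omega>
      proof -
        have "\<bar>c n \<omega> * t ^ n\<bar> \<le> (\<Sum>n<Suc n. \<bar>c n \<omega> * t ^ n\<bar>)"
          by (simp add: sum_nonneg)
        then show ?thesis using partial_le[of \<omega> "Suc n"] by linarith
      qed
      then show "AE \<omega> in M. norm (c n \<omega> * t ^ n) \<le> norm (g \<omega>)" by simp
    qed (use meas in measurable)
    have "(\<lambda>N. \<integral>\<omega>. (\<Sum>n<N. c n \<omega> * t ^ n) \<partial>M) \<longlonglongrightarrow> (\<integral>\<omega>. f t \<omega> \<partial>M)"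
    proof (rule integral_dominated_convergence[OF _ _ g])
      show "AE \<omega> in M. (\<lambda>N. \<Sum>n<N. c n \<omega> * t ^ n) \<longlonglongrightarrow> f t \<omega>"
        using sums[OF t] by (simp add: sums_def)
      show "AE \<omega> in M. norm (\<Sum>n<N. c n \<omega> * t ^ n) \<le> g \<omega>" for N
        using order_trans[OF sum_abs partial_le] by simp
    qed (use meas in measurable)
    moreover have "(\<integral>\<omega>. (\<Sum>n<N. c n \<omega> * t ^ n) \<partial>M) = (\<Sum>n<N. (\<integral>\<omega>. c n \<omega> \<partial>M) * t ^ n)" for N
    proof -
      have "(\<integral>\<omega>. c n \<omega> * t ^ n \<partial>M) = (\<integral>\<omega>. c n \<omega> \<partial>M) * t ^ n" for n
        by simp
      then show ?thesis using int by (simp add: Bochner_Integration.integral_sum)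
    qed
    ultimately show ?thesis by (simp add: sums_def)
  qed
  then show "eventually (\<lambda>t. (\<lambda>n. fps_nth (Abs_fps (\<lambda>n. \<integral>\<omega>. c n \<omega> \<partial>M)) n * t ^ n)
      sums (\<integral>\<omega>. f t \<omega> \<partial>M)) (nhds 0)"
    using s by (auto simp: eventually_nhds_metric dist_real_def)
qed

context prob_space
begin

lemma exp_moment_has_fps_expansion:
  assumes "Y \<in> borel_measurable M" "r > 0" "integrable M (\<lambda>\<omega>. exp (r * \<bar>Y \<omega>\<bar>))"
  shows "(\<lambda>t. expectation (\<lambda>\<omega>. exp (Y \<omega> * t)) - 1) has_fps_expansion exp_moment_fps M Y"
proof -
  have exp_sums: "(\<lambda>n. y ^ n / fact n * t ^ n) sums exp (y * t)" for y t :: real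
    using exp_converges[of "y * t"] by (simp add: power_mult_distrib divide_inverse mult_ac)
  have "(\<lambda>t. expectation (\<lambda>\<omega>. exp (Y \<omega> * t))) has_fps_expansion
      Abs_fps (\<lambda>n. expectation (\<lambda>\<omega>. Y \<omega> ^ n / fact n))"
  proof (rule integral_has_fps_expansion[OF assms(2) _ _ assms(3)])
    show "(\<lambda>n. \<bar>Y \<omega>\<bar> ^ n / fact n * r ^ n) sums exp (r * \<bar>Y \<omega>\<bar>)" for \<omega>
      using exp_sums[of "\<bar>Y \<omega>\<bar>" r] by (simp add: mult_ac)
  qed (use assms exp_sums in \<open>auto simp: power_abs\<close>)
  then have "(\<lambda>t. expectation (\<lambda>\<omega>. exp (Y \<omega> * t)) - 1) has_fps_expansion
      Abs_fps (\<lambda>n. expectation (\<lambda>\<omega>. Y \<omega> ^ n / fact n)) - 1"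
    by (intro has_fps_expansion_diff has_fps_expansion_1)
  also have "Abs_fps (\<lambda>n. expectation (\<lambda>\<omega>. Y \<omega> ^ n / fact n)) - 1 = exp_moment_fps M Y"
    by (rule fps_ext) (simp add: exp_moment_fps_def prob_space)
  finally show ?thesis .
qed

lemma degenerate_exp_sums:
  assumes "lam \<noteq> 0" "\<bar>lam * t\<bar> < 1"
  shows "(\<lambda>n. degenerate_falling lam x n / fact n * t ^ n) sums (1 + lam * t) powr (x / lam)"
proof -
  have "degenerate_falling lam x n / fact n * t ^ n = ((x / lam) gchoose n) * (lam * t) ^ n" for n
  proof -
    have "degenerate_falling lam x n = (\<Prod>i<n. lam * (x / lam - real i))"
      unfolding degenerate_falling_def using assms by (intro prod.cong) (auto simp: field_simps)
    also have "\<dots> = lam ^ n * (\<Prod>i<n. x / lam - real i)"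
      by (simp add: prod.distrib)
    finally show ?thesis
      by (simp add: gbinomial_prod_rev power_mult_distrib atLeast0LessThan)
  qed
  then show ?thesis using gen_binomial_real[OF assms(2)] by simp
qed

lemma degenerate_exp_moment_has_fps_expansion:
  assumes lam: "lam \<noteq> 0"
    and Y: "Y \<in> borel_measurable M" "r > 0" "integrable M (\<lambda>\<omega>. exp (r * \<bar>Y \<omega>\<bar>))"
  shows "(\<lambda>t. expectation (\<lambda>\<omega>. (1 + lam * t) powr (Y \<omega> / lam)) - 1) has_fps_expansion
    degenerate_exp_moment_fps lam M Y"
proof -
  define s where "s = (1 - exp (- r * \<bar>lam\<bar>)) / \<bar>lam\<bar>"
  have s: "s > 0" using lam Y(2) by (simp add: s_def)
  have lams: "\<bar>lam\<bar> * s = 1 - exp (- r * \<bar>lam\<bar>)" using lam by (simp add: s_def)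
  have abs_le: "\<bar>degenerate_falling lam y n\<bar> \<le> degenerate_falling (- \<bar>lam\<bar>) \<bar>y\<bar> n" for y n
    unfolding degenerate_falling_def abs_prod
  proof (intro prod_mono conjI abs_ge_zero)
    fix i
    have "\<bar>y - real i * lam\<bar> \<le> \<bar>y\<bar> + \<bar>real i * lam\<bar>" by (rule abs_triangle_ineq4)
    then show "\<bar>y - real i * lam\<bar> \<le> \<bar>y\<bar> - real i * - \<bar>lam\<bar>" by (simp add: abs_mult)
  qed
  have "(\<lambda>t. expectation (\<lambda>\<omega>. (1 + lam * t) powr (Y \<omega> / lam))) has_fps_expansion
      Abs_fps (\<lambda>n. expectation (\<lambda>\<omega>. degenerate_falling lam (Y \<omega>) n / fact n))"
  proof (rule integral_has_fps_expansion[OF s _ _ Y(3)])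
    fix \<omega> n
    have "(1 + - \<bar>lam\<bar> * s) powr (\<bar>Y \<omega>\<bar> / - \<bar>lam\<bar>) = exp (r * \<bar>Y \<omega>\<bar>)"
      using lam lams by (simp add: powr_def)
    moreover have "(\<lambda>n. degenerate_falling (- \<bar>lam\<bar>) \<bar>Y \<omega>\<bar> n / fact n * s ^ n) sums
        (1 + - \<bar>lam\<bar> * s) powr (\<bar>Y \<omega>\<bar> / - \<bar>lam\<bar>)"
      by (rule degenerate_exp_sums) (use lam lams Y(2) in auto)
    ultimately show "(\<lambda>n. degenerate_falling (- \<bar>lam\<bar>) \<bar>Y \<omega>\<bar> n / fact n * s ^ n) sums
        exp (r * \<bar>Y \<omega>\<bar>)"
      by simp
    show "\<bar>degenerate_falling lam (Y \<omega>) n / fact n\<bar> * s ^ n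
        \<le> degenerate_falling (- \<bar>lam\<bar>) \<bar>Y \<omega>\<bar> n / fact n * s ^ n"
      using abs_le s by (auto intro!: mult_right_mono divide_right_mono)
  next
    fix t \<omega> assume t: "\<bar>t\<bar> < s"
    then have "\<bar>lam\<bar> * \<bar>t\<bar> < \<bar>lam\<bar> * s" using lam by simp
    also have "\<dots> < 1" unfolding lams by simp
    finally show "(\<lambda>n. degenerate_falling lam (Y \<omega>) n / fact n * t ^ n) sums
        (1 + lam * t) powr (Y \<omega> / lam)"
      using lam by (intro degenerate_exp_sums) (auto simp: abs_mult)
  qed (use Y in \<open>auto simp: degenerate_falling_def\<close>)
  then have "(\<lambda>t. expectation (\<lambda>\<omega>. (1 + lam * t) powr (Y \<omega> / lam)) - 1) has_fps_expansion
      Abs_fps (\<lambda>n. expectation (\<lambda>\<omega>. degenerate_falling lam (Y \<omega>) n / fact n)) - 1"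
    by (intro has_fps_expansion_diff has_fps_expansion_1)
  also have "Abs_fps (\<lambda>n. expectation (\<lambda>\<omega>. degenerate_falling lam (Y \<omega>) n / fact n)) - 1 =
      degenerate_exp_moment_fps lam M Y"
    by (rule fps_ext)
      (simp add: degenerate_exp_moment_fps_def prob_space degenerate_falling_def)
  finally show ?thesis .
qed

end

end

theory Submission
  imports Defs
begin

text \<open>
  Write \<open>F\<close> for the power series of \<open>E[exp (Y t)]\<close>. For \<open>Y\<close> uniform on \<open>(a, b)\<close> it equals
  \<open>(exp (b t) - exp (a t)) / ((b - a) t) = exp (a t) * G ((b - a) t)\<close>, where
  \<open>G u = (exp u - 1) / u\<close>. The powers of \<open>G\<close> carry Stirling numbers of the second kind, because
  \<open>u ^ j * G u ^ j = (exp u - 1) ^ j\<close>; hence multiplying \<open>G ((b - a) t) ^ j\<close> by \<open>exp (a j t)\<close> gives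
  every coefficient of \<open>F ^ j\<close> as a binomial convolution (lemma \<open>uniform_mgf_fps_power_nth\<close>). The first
  identity follows by expanding \<open>(F - 1) ^ k\<close> with the binomial theorem.

  The second identity reduces to the first for every random variable with finite moments: expanding the
  generalised falling factorial in powers of its argument shows that the degenerate series is the ordinary
  one with \<open>log (1 + lam t) / lam\<close> substituted for \<open>t\<close>. Substitution commutes with taking
  \<open>k\<close>-th powers, and the powers of \<open>log (1 + lam t) / lam\<close> generate the signed Stirling numbers of
  the first kind. So the degenerate numbers are the transform
  \<open>\<Sum>m\<le>n. lam ^ (n - m) * S1 n m * S2 m k\<close> of the nondegenerate ones
  (lemma \<open>prob_degenerate_Stirling_eq_sum\<close>).
\<close>

section \<open>The exponential quotient and Stirling numbers of the second kind\<close>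

text \<open>The power series of \<open>(exp t - 1) / t\<close>.\<close>

definition exp_quotient_fps :: "real fps" where
  "exp_quotient_fps = Abs_fps (\<lambda>n. 1 / fact (Suc n))"

lemma fps_X_mult_exp_quotient: "fps_X * exp_quotient_fps = fps_exp 1 - 1"
proof (rule fps_ext)
  fix n
  show "fps_nth (fps_X * exp_quotient_fps) n = fps_nth (fps_exp 1 - 1) n"
    by (cases n) (simp_all add: exp_quotient_fps_def del: fact_Suc)
qed

text \<open>
  Dividing \<open>(exp t - 1) ^ j\<close> by \<open>t ^ j\<close> shifts its exponential coefficients by \<open>j\<close>; the
  binomial coefficient is what remains of the factorials after the shift.
\<close>

lemma exp_quotient_power_nth:
  "fps_nth (exp_quotient_fps ^ j) l =
    inverse (real ((l + j) choose j)) * real (Stirling (l + j) j) / fact l"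
proof -
  have "fps_nth (exp_quotient_fps ^ j) l = fps_nth (fps_X ^ j * exp_quotient_fps ^ j) (l + j)"
    by (simp add: fps_X_power_mult_nth)
  also have "\<dots> = fps_nth ((fps_exp 1 - 1) ^ j) (l + j)"
    by (simp add: fps_X_mult_exp_quotient flip: power_mult_distrib)
  also have "\<dots> = fact j * real (Stirling (l + j) j) / fact (l + j)"
    by (simp add: Stirling_egf)
  also have "\<dots> = inverse (real ((l + j) choose j)) * real (Stirling (l + j) j) / fact l"
    by (simp add: binomial_fact field_simps)
  finally show ?thesis .
qed

section \<open>Moments of the uniform distribution\<close>

lemma uniform_power_moment:
  assumes "a < b"
    and "distributed M lborel Y
           (\<lambda>x. ennreal (if a < x \<and> x < b then 1 / (b - a) else 0))"
  shows "integrable M (\<lambda>\<omega>. Y \<omega> ^ n)"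
    and "(\<integral>\<omega>. Y \<omega> ^ n \<partial>M) = (b ^ Suc n - a ^ Suc n) / (real (Suc n) * (b - a))"
proof -
  let ?f = "\<lambda>x. if a < x \<and> x < b then 1 / (b - a) else 0"
  let ?g = "\<lambda>x. 1 / (b - a) * (x ^ n * indicator {a..b} x)"
  have int_g: "integrable lborel ?g"
    by (intro integrable_mult_right borel_integrable_atLeastAtMost) (use assms(1) in auto)
  \<comment> \<open>The density lives on the open interval; its end points are null sets.\<close>
  have eq: "AE x in lborel. ?f x * x ^ n = ?g x"
    using AE_lborel_singleton[of a] AE_lborel_singleton[of b]
    by eventually_elim (auto simp: indicator_def)
  have "integrable lborel (\<lambda>x. ?f x * x ^ n)"
    by (subst integrable_cong_AE[OF _ _ eq]) (use int_g in auto)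
  then show "integrable M (\<lambda>\<omega>. Y \<omega> ^ n)"
    using distributed_integrable[OF assms(2), of "\<lambda>x. x ^ n"] assms(1) by simp
  have "(\<integral>\<omega>. Y \<omega> ^ n \<partial>M) = (\<integral>x. ?f x * x ^ n \<partial>lborel)"
    using distributed_integral[OF assms(2), of "\<lambda>x. x ^ n"] assms(1) by simp
  also have "\<dots> = (\<integral>x. ?g x \<partial>lborel)"
    by (intro integral_cong_AE eq) auto
  also have "\<dots> = (b ^ Suc n - a ^ Suc n) / (real (Suc n) * (b - a))"
    using assms(1) by (simp add: integral_power mult.commute)
  finally show "(\<integral>\<omega>. Y \<omega> ^ n \<partial>M) = (b ^ Suc n - a ^ Suc n) / (real (Suc n) * (b - a))" .
qed

definition mgf_fps :: "'a measure \<Rightarrow> ('a \<Rightarrow> real) \<Rightarrow> real fps" where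
  "mgf_fps M Y = Abs_fps (\<lambda>n. (\<integral>\<omega>. Y \<omega> ^ n \<partial>M) / fact n)"

lemma (in prob_space) exp_moment_fps_eq_mgf_fps: "exp_moment_fps M Y = mgf_fps M Y - 1"
  by (rule fps_ext) (simp add: exp_moment_fps_def mgf_fps_def prob_space)

text \<open>
  Both sides become \<open>exp (b t) - exp (a t)\<close> when multiplied by \<open>(b - a) * t\<close>, and the ring of
  power series has no zero divisors.
\<close>

lemma uniform_mgf_fps:
  assumes "a < b"
    and "distributed M lborel Y
           (\<lambda>x. ennreal (if a < x \<and> x < b then 1 / (b - a) else 0))"
  shows "mgf_fps M Y =
    fps_exp a * (exp_quotient_fps oo (fps_const (b - a) * fps_X))"
proof -
  let ?u = "fps_const (b - a) * fps_X"
  have "?u * mgf_fps M Y = fps_exp b - fps_exp a"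
  proof (rule fps_ext)
    fix n
    show "fps_nth (?u * mgf_fps M Y) n = fps_nth (fps_exp b - fps_exp a) n"
    proof (cases n)
      case (Suc m)
      have "fps_nth (?u * mgf_fps M Y) (Suc m) =
          (b - a) * ((b ^ Suc m - a ^ Suc m) / (real (Suc m) * (b - a)) / fact m)"
        by (simp add: mult.assoc mgf_fps_def uniform_power_moment(2)[OF assms])
      also have "\<dots> = (b ^ Suc m - a ^ Suc m) / fact (Suc m)"
        using assms(1) by (simp add: divide_simps del: power_Suc of_nat_Suc)
      finally show ?thesis
        by (simp add: Suc diff_divide_distrib del: fact_Suc power_Suc)
    qed (simp add: mult.assoc)
  qed
  moreover have "?u * (fps_exp a * (exp_quotient_fps oo ?u)) = fps_exp b - fps_exp a"
  proof -
    have "?u * (exp_quotient_fps oo ?u) = (fps_X * exp_quotient_fps) oo ?u"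
      by (simp add: fps_compose_mult_distrib)
    also have "\<dots> = fps_exp (b - a) - 1"
      by (simp add: fps_X_mult_exp_quotient fps_compose_sub_distrib)
    finally have "?u * (fps_exp a * (exp_quotient_fps oo ?u)) = fps_exp a * (fps_exp (b - a) - 1)"
      by (simp add: mult_ac)
    also have "\<dots> = fps_exp b - fps_exp a"
      by (simp add: algebra_simps flip: fps_exp_add_mult)
    finally show ?thesis .
  qed
  moreover have "?u \<noteq> 0"
    using assms(1) by simp
  ultimately show ?thesis
    by (metis mult_left_cancel)
qed

text \<open>
  The product formula above, raised to the power \<open>j\<close>: \<open>exp (a t) ^ j = exp (a j t)\<close> contributes the
  powers of \<open>a * j\<close>, and rescaling the variable of the quotient contributes \<open>(b - a) ^ l\<close>.
\<close>

lemma uniform_mgf_fps_power_nth: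
  assumes "a < b"
    and "distributed M lborel Y
           (\<lambda>x. ennreal (if a < x \<and> x < b then 1 / (b - a) else 0))"
  shows "fact n * fps_nth (mgf_fps M Y ^ j) n =
    (\<Sum>l=0..n. real (n choose l) * inverse (real ((l + j) choose j)) *
      (a * real j) ^ (n - l) * (b - a) ^ l * real (Stirling (l + j) j))"
proof -
  let ?u = "fps_const (b - a) * fps_X"
  have "mgf_fps M Y ^ j = ((exp_quotient_fps ^ j) oo ?u) * fps_exp (a * real j)"
    by (simp add: uniform_mgf_fps[OF assms] power_mult_distrib fps_compose_power
        fps_exp_power_mult mult_ac)
  then have "fact n * fps_nth (mgf_fps M Y ^ j) n =
      (\<Sum>l=0..n. fact n * ((b - a) ^ l * (inverse (real ((l + j) choose j)) *
        real (Stirling (l + j) j) / fact l) * ((a * real j) ^ (n - l) / fact (n - l))))"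
    by (simp add: fps_mult_nth fps_compose_linear exp_quotient_power_nth sum_distrib_left)
  also have "\<dots> = (\<Sum>l=0..n. real (n choose l) * inverse (real ((l + j) choose j)) *
      (a * real j) ^ (n - l) * (b - a) ^ l * real (Stirling (l + j) j))"
    by (intro sum.cong refl) (simp add: binomial_fact mult_ac divide_inverse)
  finally show ?thesis .
qed

section \<open>The nondegenerate numbers\<close>

lemma prob_Stirling_uniform:
  assumes "a < b" and "prob_space M"
    and "distributed M lborel Y
           (\<lambda>x. ennreal (if a < x \<and> x < b then 1 / (b - a) else 0))"
  shows "prob_Stirling M Y n k =
      1 / fact k *
        (\<Sum>j=0..k. \<Sum>l=0..n.
          real (n choose l) * real (k choose j) * inverse (real ((l + j) choose j)) *
          (-1) ^ (k - j) * (a * real j) ^ (n - l) * (b - a) ^ l * real (Stirling (l + j) j))"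
proof -
  let ?F = "mgf_fps M Y"
  have "exp_moment_fps M Y ^ k = (?F + (-1)) ^ k"
    by (simp add: prob_space.exp_moment_fps_eq_mgf_fps[OF assms(2)])
  also have "\<dots> = (\<Sum>j=0..k. fps_const (real (k choose j) * (-1) ^ (k - j)) * ?F ^ j)"
    unfolding binomial_ring atMost_atLeast0
    by (intro sum.cong refl)
      (simp add: fps_of_nat mult_ac flip: fps_const_mult fps_const_power fps_const_neg)
  finally have "fact n * fps_nth (exp_moment_fps M Y ^ k) n =
      (\<Sum>j=0..k. (real (k choose j) * (-1) ^ (k - j)) * (fact n * fps_nth (?F ^ j) n))"
    by (simp add: fps_sum_nth sum_distrib_left mult_ac)
  then show ?thesis
    unfolding uniform_mgf_fps_power_nth[OF assms(1,3)]
    by (simp add: prob_Stirling_def sum_distrib_left sum_divide_distrib mult_ac)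
qed

section \<open>From ordinary to degenerate moments\<close>

text \<open>
  The falling factorial with step \<open>lam\<close> is a rescaled rising factorial at \<open>- x / lam\<close>, whose
  coefficients are the unsigned Stirling numbers of the first kind.
\<close>

lemma degenerate_falling_eq_sum:
  assumes "lam \<noteq> 0"
  shows "degenerate_falling lam x n =
    (\<Sum>m=0..n. lam ^ (n - m) * signed_stirling1 n m * x ^ m)"
proof -
  have "degenerate_falling lam x n = (\<Prod>i<n. (- lam) * (- x / lam + real i))"
    unfolding degenerate_falling_def
    by (intro prod.cong refl) (use assms in \<open>simp add: field_simps\<close>)
  also have "\<dots> = (- lam) ^ n * pochhammer (- x / lam) n"
    unfolding prod.distrib by (simp add: pochhammer_prod atLeast0LessThan)
  also have "\<dots> = (\<Sum>m=0..n. (- lam) ^ n * (real (stirling n m) * (- x / lam) ^ m))"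
    by (simp add: sum_distrib_left flip: stirling_pochhammer atMost_atLeast0)
  also have "\<dots> = (\<Sum>m=0..n. lam ^ (n - m) * signed_stirling1 n m * x ^ m)"
  proof (intro sum.cong refl)
    fix m assume "m \<in> {0..n}"
    then have "lam ^ n = lam ^ (n - m) * lam ^ m"
      by (simp flip: power_add)
    moreover have "(- lam) ^ n = (-1) ^ n * lam ^ n" "(- x / lam) ^ m = (-1) ^ m * (x ^ m / lam ^ m)"
      by (simp_all add: power_minus[of lam] power_minus[of "x / lam"] power_divide)
    ultimately show "(- lam) ^ n * (real (stirling n m) * (- x / lam) ^ m) =
        lam ^ (n - m) * signed_stirling1 n m * x ^ m"
      using assms by (simp add: signed_stirling1_eq power_add mult_ac)
  qed
  finally show ?thesis .
qed

text \<open>The series \<open>L\<close> for which \<open>exp (x * L t) = (1 + lam * t) powr (x / lam)\<close>.\<close>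

definition degenerate_log_fps :: "real \<Rightarrow> real fps" where
  "degenerate_log_fps lam = fps_const (1 / lam) * (fps_ln 1 oo (fps_const lam * fps_X))"

lemma degenerate_log_fps_nth_0: "fps_nth (degenerate_log_fps lam) 0 = 0"
  by (simp add: degenerate_log_fps_def)

lemma degenerate_log_power_nth:
  assumes "lam \<noteq> 0" "m \<le> n"
  shows "fact n * fps_nth (degenerate_log_fps lam ^ m) n =
    fact m * lam ^ (n - m) * signed_stirling1 n m"
proof -
  have "degenerate_log_fps lam ^ m =
      fps_const (1 / lam ^ m) * ((fps_ln 1 ^ m) oo (fps_const lam * fps_X))"
    by (simp add: degenerate_log_fps_def power_mult_distrib fps_compose_power
        fps_const_power power_divide)
  moreover have "lam ^ n = lam ^ (n - m) * lam ^ m"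
    using assms(2) by (simp flip: power_add)
  ultimately show ?thesis
    using assms(1) by (simp add: fps_compose_linear signed_stirling1_def)
qed

text \<open>
  Taking expectations in the expansion of the falling factorial: this is \<open>E[(1 + lam t) powr (Y / lam)]\<close>
  rewritten as \<open>E[exp (Y * log (1 + lam t) / lam)]\<close>, at the level of coefficients.
\<close>

lemma degenerate_exp_moment_fps_eq_compose:
  assumes "lam \<noteq> 0" and "\<And>n. integrable M (\<lambda>\<omega>. Y \<omega> ^ n)"
  shows "degenerate_exp_moment_fps lam M Y = exp_moment_fps M Y oo degenerate_log_fps lam"
proof (rule fps_ext)
  fix n
  show "fps_nth (degenerate_exp_moment_fps lam M Y) n =
      fps_nth (exp_moment_fps M Y oo degenerate_log_fps lam) n"
  proof (cases "n = 0")
    case False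
    \<comment> \<open>The summand \<open>m = 0\<close>, where the moment series lacks its constant term, vanishes as \<open>n > 0\<close>.\<close>
    then have S10: "signed_stirling1 n 0 = 0"
      by (simp add: signed_stirling1_def)
    have "(\<integral>\<omega>. degenerate_falling lam (Y \<omega>) n \<partial>M) =
        (\<Sum>m=0..n. lam ^ (n - m) * signed_stirling1 n m * (\<integral>\<omega>. Y \<omega> ^ m \<partial>M))"
      by (simp add: degenerate_falling_eq_sum[OF assms(1)] assms(2))
    also have "\<dots> = (\<Sum>m=0..n. fps_nth (exp_moment_fps M Y) m *
        (fact m * lam ^ (n - m) * signed_stirling1 n m))"
      by (intro sum.cong refl) (auto simp: exp_moment_fps_def S10)
    also have "\<dots> = (\<Sum>m=0..n. fps_nth (exp_moment_fps M Y) m *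
        (fact n * fps_nth (degenerate_log_fps lam ^ m) n))"
      by (intro sum.cong refl) (simp add: degenerate_log_power_nth[OF assms(1)])
    also have "\<dots> = fact n * fps_nth (exp_moment_fps M Y oo degenerate_log_fps lam) n"
      by (simp add: fps_compose_nth sum_distrib_left mult_ac)
    finally show ?thesis
      using False by (simp add: degenerate_exp_moment_fps_def)
  qed (simp add: degenerate_exp_moment_fps_def exp_moment_fps_def)
qed

lemma prob_degenerate_Stirling_eq_sum:
  assumes "lam \<noteq> 0" and "\<And>n. integrable M (\<lambda>\<omega>. Y \<omega> ^ n)"
  shows "prob_degenerate_Stirling lam M Y n k =
    (\<Sum>m=0..n. lam ^ (n - m) * signed_stirling1 n m * prob_Stirling M Y m k)"
proof -
  let ?E = "exp_moment_fps M Y" and ?L = "degenerate_log_fps lam"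
  have "degenerate_exp_moment_fps lam M Y ^ k = (?E ^ k) oo ?L"
    by (simp add: degenerate_exp_moment_fps_eq_compose[OF assms] fps_compose_power
        degenerate_log_fps_nth_0)
  then have "prob_degenerate_Stirling lam M Y n k =
      (\<Sum>m=0..n. 1 / fact k * fps_nth (?E ^ k) m * (fact n * fps_nth (?L ^ m) n))"
    by (simp add: prob_degenerate_Stirling_def fps_compose_nth sum_distrib_left sum_divide_distrib mult_ac)
  also have "\<dots> = (\<Sum>m=0..n. lam ^ (n - m) * signed_stirling1 n m * prob_Stirling M Y m k)"
    by (intro sum.cong refl) (simp add: degenerate_log_power_nth[OF assms(1)] prob_Stirling_def)
  finally show ?thesis .
qed

section \<open>The uniform random variable\<close>

theorem theorem2p8:
  fixes lam a b :: real and M :: "'a measure" and Y :: "'a \<Rightarrow> real" and n k :: nat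
  assumes "lam \<noteq> 0"
    and "a < b"
    and "a + b \<noteq> 0"
    and "prob_space M"
    and "distributed M lborel Y
           (\<lambda>x. ennreal (if a < x \<and> x < b then 1 / (b - a) else 0))"
    and "k \<le> n"
  shows "prob_Stirling M Y n k =
      1 / fact k *
        (\<Sum>j=0..k. \<Sum>l=0..n.
          real (n choose l) * real (k choose j) * inverse (real ((l + j) choose j)) *
          (-1) ^ (k - j) * (a * real j) ^ (n - l) * (b - a) ^ l * real (Stirling (l + j) j))
    \<and> prob_degenerate_Stirling lam M Y n k =
      1 / fact k *
        (\<Sum>m=0..n. \<Sum>j=0..k. \<Sum>l=0..m.
          real (m choose l) * real (k choose j) * inverse (real ((l + j) choose j)) *
          (-1) ^ (k - j) * (a * real j) ^ (m - l) * (b - a) ^ l * lam ^ (n - m) *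
          real (Stirling (l + j) j) * signed_stirling1 n m)"
proof
  note S2 = prob_Stirling_uniform[OF assms(2,4,5)]
  show "prob_Stirling M Y n k =
      1 / fact k *
        (\<Sum>j=0..k. \<Sum>l=0..n.
          real (n choose l) * real (k choose j) * inverse (real ((l + j) choose j)) *
          (-1) ^ (k - j) * (a * real j) ^ (n - l) * (b - a) ^ l * real (Stirling (l + j) j))"
    by (rule S2)
  show "prob_degenerate_Stirling lam M Y n k =
      1 / fact k *
        (\<Sum>m=0..n. \<Sum>j=0..k. \<Sum>l=0..m.
          real (m choose l) * real (k choose j) * inverse (real ((l + j) choose j)) *
          (-1) ^ (k - j) * (a * real j) ^ (m - l) * (b - a) ^ l * lam ^ (n - m) *
          real (Stirling (l + j) j) * signed_stirling1 n m)"
    unfolding prob_degenerate_Stirling_eq_sum[OF assms(1) uniform_power_moment(1)[OF assms(2,5)]] S2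
    by (simp add: sum_distrib_left mult_ac)
qed

end
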